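(* For every nonnegative integer $s$, the number $MC_3(s)$ of $3\times 3\times 3$ magic cubes of magic sum $s$ is $$MC_3(s)=\begin{cases}\frac{11}{324}s^4+\frac{11}{54}s^3+\frac{25}{36}s^2+\frac{7}{6}s+1 & \text{if } 3\mid s,\\ 0&\text{otherwise.}\end{cases}$$
   Context: An $n\times n\times n$ magic cube of magic sum $s$ is an $n\times n\times n$ array $(x_{i,j,k})$ of nonnegative integers (not required to be distinct) such that the entries along every line parallel to a coordinate axis sum to $s$, and the entries along each of the 4 main diagonals of the cube (the images of $x_{1,1,1},x_{2,2,2},\dots,x_{n,n,n}$ under the symmetries of the cube) sum to $s$. *)

theory Defs
  imports Complex_Main "HOL-Library.FuncSet"
begin

type_synonym cell = "nat \<times> nat \<times> nat"

definition cells :: "nat \<Rightarrow> cell set" where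
  "cells n = {1..n} \<times> {1..n} \<times> {1..n}"

text \<open>
  The symmetries of the cube, as maps of the cell coordinates \<open>1, \<dots>, n\<close>: the maps generated
  by two transpositions of the axes and the reflection in one axis. (These generate all
  48 symmetries, rotations and reflections.)
\<close>

inductive_set cube_symmetries :: "nat \<Rightarrow> (cell \<Rightarrow> cell) set" for n where
  ident: "id \<in> cube_symmetries n"
| swap12: "\<sigma> \<in> cube_symmetries n \<Longrightarrow> (\<lambda>(i, j, k). (j, i, k)) \<circ> \<sigma> \<in> cube_symmetries n"
| swap23: "\<sigma> \<in> cube_symmetries n \<Longrightarrow> (\<lambda>(i, j, k). (i, k, j)) \<circ> \<sigma> \<in> cube_symmetries n"
| reflect: "\<sigma> \<in> cube_symmetries n \<Longrightarrow> (\<lambda>(i, j, k). (n + 1 - i, j, k)) \<circ> \<sigma> \<in> cube_symmetries n"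

definition main_diagonals :: "nat \<Rightarrow> cell set set" where
  "main_diagonals n = {\<sigma> ` {(i, i, i) | i. i \<in> {1..n}} | \<sigma>. \<sigma> \<in> cube_symmetries n}"

text \<open>
  An array is an extensional function on the cells (\<open>undefined\<close> elsewhere), so that
  two arrays with the same entries are equal and arrays can be counted.
\<close>

definition magic_cubes :: "nat \<Rightarrow> nat \<Rightarrow> (cell \<Rightarrow> nat) set" where
  "magic_cubes n s = {x \<in> cells n \<rightarrow>\<^sub>E UNIV.
     (\<forall>a\<in>{1..n}. \<forall>b\<in>{1..n}.
        (\<Sum>t\<in>{1..n}. x (t, a, b)) = s \<and>
        (\<Sum>t\<in>{1..n}. x (a, t, b)) = s \<and>
        (\<Sum>t\<in>{1..n}. x (a, b, t)) = s) \<and>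
     (\<forall>D\<in>main_diagonals n. (\<Sum>c\<in>D. x c) = s)}"

definition MC :: "nat \<Rightarrow> nat \<Rightarrow> nat" where
  "MC n s = card (magic_cubes n s)"

lemma main_diagonals_eq:
  "main_diagonals n =
     {(\<lambda>i. (i, i, i)) ` {1..n}, (\<lambda>i. (n + 1 - i, i, i)) ` {1..n},
      (\<lambda>i. (i, n + 1 - i, i)) ` {1..n}, (\<lambda>i. (i, i, n + 1 - i)) ` {1..n}}"
  (is "_ = {?A, ?B, ?C, ?D}")
proof -
  let ?d = "{(i, i, i) | i. i \<in> {1..n}}"
  let ?p = "\<lambda>(i::nat, j::nat, k::nat). (j, i, k)"
  let ?q = "\<lambda>(i::nat, j::nat, k::nat). (i, k, j)"
  let ?r = "\<lambda>(i::nat, j::nat, k::nat). (n + 1 - i, j, k)"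
  have d: "?d = ?A" by auto
  have rev: "(\<lambda>i. f (n + 1 - i) i) ` {1..n} = (\<lambda>i. f i (n + 1 - i)) ` {1..n}"
    for f :: "nat \<Rightarrow> nat \<Rightarrow> cell"
  proof (intro equalityI image_subsetI)
    fix i assume i: "i \<in> {1..n}"
    show "f (n + 1 - i) i \<in> (\<lambda>i. f i (n + 1 - i)) ` {1..n}"
      using i by (intro image_eqI[where x = "n + 1 - i"]) auto
    show "f i (n + 1 - i) \<in> (\<lambda>i. f (n + 1 - i) i) ` {1..n}"
      using i by (intro image_eqI[where x = "n + 1 - i"]) auto
  qed
  have p: "?p ` ?A = ?A" "?p ` ?B = ?C" "?p ` ?C = ?B" "?p ` ?D = ?D"
    by (simp_all add: image_image)
  have q: "?q ` ?A = ?A" "?q ` ?B = ?B" "?q ` ?C = ?D" "?q ` ?D = ?C"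
    by (simp_all add: image_image)
  have r1: "?r ` ?A = ?B" by (simp add: image_image)
  have r2: "?r ` ?B = ?A" by (simp add: image_image cong: image_cong_simp)
  have r3: "?r ` ?C = ?D" using rev[of "\<lambda>a b. (a, a, b)"] by (simp add: image_image)
  have r4: "?r ` ?D = ?C" using rev[of "\<lambda>a b. (a, b, a)"] by (simp add: image_image)
  have sub: "\<sigma> ` ?d \<in> {?A, ?B, ?C, ?D}" if "\<sigma> \<in> cube_symmetries n" for \<sigma>
    using that
  proof induction
    case ident
    show ?case unfolding image_id by (simp only: d id_apply) simp
  next
    case (swap12 \<sigma>)
    then show ?case unfolding image_comp[symmetric] by (elim insertE emptyE) (simp_all only: p, simp_all)
  next
    case (swap23 \<sigma>)
    then show ?case unfolding image_comp[symmetric] by (elim insertE emptyE) (simp_all only: q, simp_all)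
  next
    case (reflect \<sigma>)
    then show ?case unfolding image_comp[symmetric] by (elim insertE emptyE) (simp_all only: r1 r2 r3 r4, simp_all)
  qed
  have step: "\<tau> ` E \<in> main_diagonals n"
    if E0: "E \<in> main_diagonals n" and cl: "\<And>\<sigma>. \<sigma> \<in> cube_symmetries n \<Longrightarrow> \<tau> \<circ> \<sigma> \<in> cube_symmetries n" for \<tau> E
  proof -
    obtain \<sigma> where s: "\<sigma> \<in> cube_symmetries n" and E: "E = \<sigma> ` ?d"
      using E0 unfolding main_diagonals_def by blast
    have "\<tau> ` E = (\<tau> \<circ> \<sigma>) ` ?d" unfolding E by (rule image_comp)
    then show ?thesis
      using cl[OF s] unfolding main_diagonals_def by blast
  qed
  have A: "?A \<in> main_diagonals n"
    unfolding main_diagonals_def d[symmetric] mem_Collect_eq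
    by (rule exI[of _ id]) (simp only: image_id id_apply cube_symmetries.ident simp_thms)
  have B: "?B \<in> main_diagonals n"
    using step[OF A cube_symmetries.reflect] unfolding r1 .
  have C: "?C \<in> main_diagonals n"
    using step[OF B cube_symmetries.swap12] unfolding p .
  have D: "?D \<in> main_diagonals n"
    using step[OF C cube_symmetries.swap23] unfolding q .
  have "main_diagonals n \<subseteq> {?A, ?B, ?C, ?D}"
  proof
    fix E assume "E \<in> main_diagonals n"
    then obtain \<sigma> where s: "\<sigma> \<in> cube_symmetries n" and E: "E = \<sigma> ` ?d"
      unfolding main_diagonals_def by blast
    show "E \<in> {?A, ?B, ?C, ?D}" unfolding E by (rule sub[OF s])
  qed
  moreover have "{?A, ?B, ?C, ?D} \<subseteq> main_diagonals n"
    by (simp only: insert_subset A B C D empty_subsetI simp_thms)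
  ultimately show ?thesis by (rule equalityI)
qed

lemma finite_magic_cubes: "finite (magic_cubes n s)"
proof (rule finite_subset)
  show "magic_cubes n s \<subseteq> cells n \<rightarrow>\<^sub>E {..s}"
  proof
    fix x assume x: "x \<in> magic_cubes n s"
    have "x (i, j, k) \<le> s" if "i \<in> {1..n}" "j \<in> {1..n}" "k \<in> {1..n}" for i j k
      using x that member_le_sum[of k "{1..n}" "\<lambda>t. x (i, j, t)"]
      by (auto simp: magic_cubes_def)
    then show "x \<in> cells n \<rightarrow>\<^sub>E {..s}"
      using x by (auto simp: magic_cubes_def cells_def PiE_iff)
  qed
  show "finite (cells n \<rightarrow>\<^sub>E {..s})"
    by (intro finite_PiE) (auto simp: cells_def)
qed

end

theory Submission
  imports Defs
begin

text \<open>
  The line and diagonal conditions force \<open>s = 3t\<close> with \<open>t\<close> the central entry, and after subtracting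
  \<open>t\<close> everywhere the cube is antisymmetric with zero line sums, hence determined by four pairwise
  non-adjacent corners \<open>a, b, c, d\<close>. The edge entries are differences of two of these numbers and
  the face entries are \<open>p = a + b - c - d\<close>, \<open>q = a + c - b - d\<close>, \<open>r = a + d - b - c\<close> up to sign, and
  nonnegativity bounds all of them by \<open>t\<close> in absolute value. We sum over \<open>(p, q, r)\<close>, three numbers
  of equal parity: they fix \<open>a, b, c, d\<close> up to a common translation, and the spread
  \<open>max - min\<close> of \<open>a, b, c, d\<close> is half the sum of the two largest of \<open>\<bar>p\<bar>, \<bar>q\<bar>, \<bar>r\<bar>\<close>,
  which leaves \<open>2t + 1 - spread\<close> translations. The sum of the spreads over one parity class is a
  quasipolynomial whose parity-dependent terms cancel when both classes are added.
\<close>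

section \<open>Magic cubes as integer points of a polytope\<close>

text \<open>
  The bounds \<open>\<bar>a - b\<bar> \<le> t\<close> etc. coming from the edges of the cube follow by adding two of the
  bounds coming from the faces.
\<close>

definition corner_quadruples :: "nat \<Rightarrow> (int \<times> int \<times> int \<times> int) set" where
  "corner_quadruples t = {(a, b, c, d).
     \<bar>a\<bar> \<le> int t \<and> \<bar>b\<bar> \<le> int t \<and> \<bar>c\<bar> \<le> int t \<and> \<bar>d\<bar> \<le> int t \<and>
     \<bar>a + b - c - d\<bar> \<le> int t \<and> \<bar>a + c - b - d\<bar> \<le> int t \<and> \<bar>a + d - b - c\<bar> \<le> int t}"

text \<open>The entry at coordinate 2 is the one that makes the line sum vanish.\<close>

definition fill :: "(nat \<Rightarrow> int) \<Rightarrow> nat \<Rightarrow> int" where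
  "fill f i = (if i = 2 then - (f 1 + f 3) else f i)"

text \<open>
  The corners \<open>(3,3,3), (3,1,1), (1,3,1), (1,1,3)\<close> carry \<open>a, b, c, d\<close>; the product of the
  \<open>\<plusminus>1\<close> factors makes opposite corners negatives of each other.
\<close>

definition corner_entry :: "int \<times> int \<times> int \<times> int \<Rightarrow> nat \<Rightarrow> nat \<Rightarrow> nat \<Rightarrow> int" where
  "corner_entry = (\<lambda>(a, b, c, d) i j k.
     (int i - 2) * (int j - 2) * (int k - 2) *
     (if j = k then if i = j then a else b else if i = k then c else d))"

text \<open>The three fills act linearly on separate coordinates, so they commute; hence lines in
  every direction sum to zero, not only those along the outermost one.\<close>

definition centred_entry :: "int \<times> int \<times> int \<times> int \<Rightarrow> nat \<Rightarrow> nat \<Rightarrow> nat \<Rightarrow> int" where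
  "centred_entry v i j k =
     fill (\<lambda>i. fill (\<lambda>j. fill (\<lambda>k. corner_entry v i j k) k) j) i"

definition cube_of_corners :: "nat \<Rightarrow> int \<times> int \<times> int \<times> int \<Rightarrow> cell \<Rightarrow> nat" where
  "cube_of_corners t v = restrict (\<lambda>(i, j, k). nat (int t + centred_entry v i j k)) (cells 3)"

definition corners_of_cube :: "nat \<Rightarrow> (cell \<Rightarrow> nat) \<Rightarrow> int \<times> int \<times> int \<times> int" where
  "corners_of_cube t x = (int (x (3, 3, 3)) - int t, int (x (3, 1, 1)) - int t,
     int (x (1, 3, 1)) - int t, int (x (1, 1, 3)) - int t)"

section \<open>Linear relations in a magic cube of side 3\<close>

lemma atLeastAtMost_1_3: "{1..3} = {1, 2, 3::nat}"
  by auto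

lemma magic_cubes_3_iff:
  "x \<in> magic_cubes 3 s \<longleftrightarrow> x \<in> cells 3 \<rightarrow>\<^sub>E UNIV \<and>
     (\<forall>a\<in>{1, 2, 3}. \<forall>b\<in>{1, 2, 3}.
        x (1, a, b) + x (2, a, b) + x (3, a, b) = s \<and>
        x (a, 1, b) + x (a, 2, b) + x (a, 3, b) = s \<and>
        x (a, b, 1) + x (a, b, 2) + x (a, b, 3) = s) \<and>
     x (1, 1, 1) + x (2, 2, 2) + x (3, 3, 3) = s \<and>
     x (3, 1, 1) + x (2, 2, 2) + x (1, 3, 3) = s \<and>
     x (1, 3, 1) + x (2, 2, 2) + x (3, 1, 3) = s \<and>
     x (1, 1, 3) + x (2, 2, 2) + x (3, 3, 1) = s"
  unfolding magic_cubes_def main_diagonals_eq atLeastAtMost_1_3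
  by (simp add: add.assoc)

text \<open>With centre c, the diagonals give the eight corners the sum 4s - 4c. The layer with
  third coordinate 2 gives its four corner cells the sum s + c. Together these cells make up four
  full edges, of sum 4s.\<close>

lemma magic_cube_centre:
  assumes "x \<in> magic_cubes 3 s"
  shows "3 * x (2, 2, 2) = s"
proof -
  have diagonals: "x (1, 1, 1) + x (2, 2, 2) + x (3, 3, 3) = s"
     "x (3, 1, 1) + x (2, 2, 2) + x (1, 3, 3) = s"
     "x (1, 3, 1) + x (2, 2, 2) + x (3, 1, 3) = s"
     "x (1, 1, 3) + x (2, 2, 2) + x (3, 3, 1) = s"
    using assms unfolding magic_cubes_3_iff by blast+
  have edges: "x (1, 1, 1) + x (1, 1, 2) + x (1, 1, 3) = s"
    "x (1, 3, 1) + x (1, 3, 2) + x (1, 3, 3) = s"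
    "x (3, 1, 1) + x (3, 1, 2) + x (3, 1, 3) = s"
    "x (3, 3, 1) + x (3, 3, 2) + x (3, 3, 3) = s"
    using assms unfolding magic_cubes_3_iff by blast+
  have middle: "x (1, 1, 2) + x (2, 1, 2) + x (3, 1, 2) = s"
    "x (1, 3, 2) + x (2, 3, 2) + x (3, 3, 2) = s"
    "x (2, 1, 2) + x (2, 2, 2) + x (2, 3, 2) = s"
    using assms unfolding magic_cubes_3_iff by blast+
  show ?thesis using diagonals edges middle by linarith
qed

lemma fill_eqI:
  assumes "f 1 = g 1" "f 3 = g 3" "g 2 = - (g 1 + g 3)" "k \<in> {1, 2, 3}"
  shows "fill f k = g k"
  using assms by (auto simp: fill_def)

lemma centred_entry_corners_of_cube:
  assumes x: "x \<in> magic_cubes 3 (3 * t)" and "i \<in> {1, 2, 3}" "j \<in> {1, 2, 3}" "k \<in> {1, 2, 3}"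
  shows "centred_entry (corners_of_cube t x) i j k = int (x (i, j, k)) - int t"
proof -
  define y where "y i j k = int (x (i, j, k)) - int t" for i j k
  have centre: "y 2 2 2 = 0"
    using magic_cube_centre[OF x] by (simp add: y_def)
  have lines: "y 2 a b = - (y 1 a b + y 3 a b)" "y a 2 b = - (y a 1 b + y a 3 b)"
      "y a b 2 = - (y a b 1 + y a b 3)" if "a \<in> {1, 2, 3}" "b \<in> {1, 2, 3}" for a b
  proof -
    have "x (1, a, b) + x (2, a, b) + x (3, a, b) = 3 * t"
      "x (a, 1, b) + x (a, 2, b) + x (a, 3, b) = 3 * t"
      "x (a, b, 1) + x (a, b, 2) + x (a, b, 3) = 3 * t"
      using x that unfolding magic_cubes_3_iff by blast+
    then show "y 2 a b = - (y 1 a b + y 3 a b)" "y a 2 b = - (y a 1 b + y a 3 b)"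
      "y a b 2 = - (y a b 1 + y a b 3)" by (simp_all add: y_def)
  qed
  have "x (1, 1, 1) + x (2, 2, 2) + x (3, 3, 3) = 3 * t"
     "x (3, 1, 1) + x (2, 2, 2) + x (1, 3, 3) = 3 * t"
     "x (1, 3, 1) + x (2, 2, 2) + x (3, 1, 3) = 3 * t"
     "x (1, 1, 3) + x (2, 2, 2) + x (3, 3, 1) = 3 * t"
    using x unfolding magic_cubes_3_iff by blast+
  then have diagonals: "y 1 1 1 = - y 3 3 3" "y 1 3 3 = - y 3 1 1" "y 3 1 3 = - y 1 3 1"
      "y 3 3 1 = - y 1 1 3"
    using centre by (simp_all add: y_def)
  have corner: "corner_entry (corners_of_cube t x) i j k = y i j k"
    if "i \<in> {1, 3}" "j \<in> {1, 3}" "k \<in> {1, 3}" for i j k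
    using that diagonals by (auto simp: corner_entry_def corners_of_cube_def y_def)
  \<comment> \<open>One coordinate at a time is now allowed to be 2; each time the zero line sum
    forces the new entry.\<close>
  have edge: "fill (\<lambda>k. corner_entry (corners_of_cube t x) i j k) k = y i j k"
    if "i \<in> {1, 3}" "j \<in> {1, 3}" "k \<in> {1, 2, 3}" for i j k
    by (rule fill_eqI; (rule corner lines)?; use that in blast)
  have face: "fill (\<lambda>j. fill (\<lambda>k. corner_entry (corners_of_cube t x) i j k) k) j = y i j k"
    if "i \<in> {1, 3}" "j \<in> {1, 2, 3}" "k \<in> {1, 2, 3}" for i j k
    by (rule fill_eqI[where g = "\<lambda>j. y i j k"]; (rule edge lines)?; use that in blast)
  have "centred_entry (corners_of_cube t x) i j k = y i j k"
    unfolding centred_entry_def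
    by (rule fill_eqI[where g = "\<lambda>i. y i j k"]; (rule face lines)?; use assms(2-4) in blast)
  then show ?thesis by (simp add: y_def)
qed

section \<open>The bijection with corner quadruples\<close>

lemma abs_centred_entry_le:
  assumes "v \<in> corner_quadruples t" "i \<in> {1, 2, 3}" "j \<in> {1, 2, 3}" "k \<in> {1, 2, 3}"
  shows "\<bar>centred_entry v i j k\<bar> \<le> int t"
proof -
  obtain a b c d where v: "v = (a, b, c, d)" by (cases v)
  show ?thesis
    using assms unfolding v corner_quadruples_def abs_le_iff
    by (elim insertE emptyE) (simp_all add: centred_entry_def fill_def corner_entry_def)
qed

lemma bij_betw_corners_of_cube:
  "bij_betw (corners_of_cube t) (magic_cubes 3 (3 * t)) (corner_quadruples t)"
proof (rule bij_betw_byWitness[where f' = "cube_of_corners t"])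
  show "\<forall>x\<in>magic_cubes 3 (3 * t). cube_of_corners t (corners_of_cube t x) = x"
  proof
    fix x assume x: "x \<in> magic_cubes 3 (3 * t)"
    then have "x \<in> extensional (cells 3)" by (auto simp: magic_cubes_3_iff PiE_def)
    moreover have "cube_of_corners t (corners_of_cube t x) c = x c" if "c \<in> cells 3" for c
    proof -
      obtain i j k where c: "c = (i, j, k)" by (cases c)
      with that have "i \<in> {1, 2, 3}" "j \<in> {1, 2, 3}" "k \<in> {1, 2, 3}"
        unfolding cells_def atLeastAtMost_1_3 by blast+
      with that centred_entry_corners_of_cube[OF x] show ?thesis
        by (simp only: c cube_of_corners_def restrict_apply if_True prod.case
          add_diff_cancel_left' add_diff_eq nat_int)
    qed
    ultimately show "cube_of_corners t (corners_of_cube t x) = x"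
      by (intro extensionalityI[of _ "cells 3"]) (auto simp: cube_of_corners_def)
  qed
  show "\<forall>v\<in>corner_quadruples t. corners_of_cube t (cube_of_corners t v) = v"
    by (auto simp: corner_quadruples_def corners_of_cube_def cube_of_corners_def cells_def
        centred_entry_def fill_def corner_entry_def)
  show "corners_of_cube t ` magic_cubes 3 (3 * t) \<subseteq> corner_quadruples t"
  proof
    fix v assume "v \<in> corners_of_cube t ` magic_cubes 3 (3 * t)"
    then obtain x where x: "x \<in> magic_cubes 3 (3 * t)" and v: "v = corners_of_cube t x" by blast
    \<comment> \<open>Lower bounds suffice: opposite cells carry opposite values, so the opposite
      cell supplies the upper bound.\<close>
    have ge: "centred_entry v i j k \<ge> - int t"
      if "i \<in> {1, 2, 3}" "j \<in> {1, 2, 3}" "k \<in> {1, 2, 3}" for i j k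
      using centred_entry_corners_of_cube[OF x that] by (simp add: v)
    obtain a b c d where "v = (a, b, c, d)" by (cases v)
    then show "v \<in> corner_quadruples t"
      using ge[of 3 3 3] ge[of 3 1 1] ge[of 1 3 1] ge[of 1 1 3]
        ge[of 1 1 1] ge[of 1 3 3] ge[of 3 1 3] ge[of 3 3 1]
        ge[of 3 2 2] ge[of 2 3 2] ge[of 2 2 3] ge[of 1 2 2] ge[of 2 1 2] ge[of 2 2 1]
      by (simp add: corner_quadruples_def centred_entry_def fill_def corner_entry_def abs_le_iff)
  qed
  show "cube_of_corners t ` corner_quadruples t \<subseteq> magic_cubes 3 (3 * t)"
  proof
    fix x assume "x \<in> cube_of_corners t ` corner_quadruples t"
    then obtain v where v: "v \<in> corner_quadruples t" and x: "x = cube_of_corners t v" by blast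
    \<comment> \<open>By \<open>abs_centred_entry_le\<close> the argument of \<open>nat\<close> is
      nonnegative, so nothing is truncated.\<close>
    have entry: "int (x (i, j, k)) = int t + centred_entry v i j k"
      if "i \<in> {1, 2, 3}" "j \<in> {1, 2, 3}" "k \<in> {1, 2, 3}" for i j k
    proof -
      have "(i, j, k) \<in> cells 3"
        using that unfolding cells_def atLeastAtMost_1_3 by blast
      with abs_centred_entry_le[OF v that] show ?thesis
        by (simp add: x cube_of_corners_def)
    qed
    have ext: "x \<in> cells 3 \<rightarrow>\<^sub>E UNIV" by (auto simp: x cube_of_corners_def)
    have lines: "int (x (1, a, b) + x (2, a, b) + x (3, a, b)) = int (3 * t)"
        "int (x (a, 1, b) + x (a, 2, b) + x (a, 3, b)) = int (3 * t)"
        "int (x (a, b, 1) + x (a, b, 2) + x (a, b, 3)) = int (3 * t)"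
      if "a \<in> {1, 2, 3}" "b \<in> {1, 2, 3}" for a b
      using that unfolding of_nat_add by (simp_all add: entry centred_entry_def fill_def)
    obtain a b c d where "v = (a, b, c, d)" by (cases v)
    then have diagonals: "int (x (1, 1, 1) + x (2, 2, 2) + x (3, 3, 3)) = int (3 * t)"
       "int (x (3, 1, 1) + x (2, 2, 2) + x (1, 3, 3)) = int (3 * t)"
       "int (x (1, 3, 1) + x (2, 2, 2) + x (3, 1, 3)) = int (3 * t)"
       "int (x (1, 1, 3) + x (2, 2, 2) + x (3, 3, 1)) = int (3 * t)"
      unfolding of_nat_add by (simp_all add: entry centred_entry_def fill_def corner_entry_def)
    show "x \<in> magic_cubes 3 (3 * t)"
      unfolding magic_cubes_3_iff
      by (intro conjI ballI ext lines[unfolded of_nat_eq_iff] diagonals[unfolded of_nat_eq_iff])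
  qed
qed

section \<open>Fibring over the centred face entries\<close>

text \<open>Numbers bounded by t whose parity differs from that of t are bounded by t - 1. So the
  admissible triples of equal parity split into the classes for t and for t - 1.\<close>

definition parity_class :: "nat \<Rightarrow> int set" where
  "parity_class n = {p. \<bar>p\<bar> \<le> int n \<and> even (p - int n)}"

text \<open>The two largest are written as the total minus the minimum because a minimum is easily
  summed over a product set. Equal parity makes the division exact, see
  \<open>double_spread\<close>.\<close>

definition spread :: "int \<times> int \<times> int \<Rightarrow> int" where
  "spread = (\<lambda>(p, q, r). (\<bar>p\<bar> + \<bar>q\<bar> + \<bar>r\<bar> - min \<bar>p\<bar> (min \<bar>q\<bar> \<bar>r\<bar>)) div 2)"

abbreviation cube3 :: "'a set \<Rightarrow> ('a \<times> 'a \<times> 'a) set" where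
  "cube3 P \<equiv> P \<times> P \<times> P"

section \<open>Counting and summing over parity classes\<close>

lemma finite_parity_class [simp]: "finite (parity_class n)"
  by (rule finite_subset[of _ "{- int n..int n}"]) (auto simp: parity_class_def)

lemma finite_cube3_parity_class [simp]: "finite (cube3 (parity_class n))"
  by simp

lemma parity_classE:
  assumes "p \<in> parity_class n"
  obtains j where "p = int n + 2 * j" "\<bar>p\<bar> \<le> int n"
proof -
  from assms obtain j where "p - int n = 2 * j" by (auto simp: parity_class_def simp del: even_diff)
  with assms that[of j] show thesis by (simp add: parity_class_def)
qed

text \<open>The tail consists of n, n - 2, ... down to the last term that is at least m, and the
  negatives of these; as m is positive, the two progressions are disjoint.\<close>

lemma parity_class_tail:
  assumes "1 \<le> m" "m \<le> n"
  shows "card {p \<in> parity_class n. int m \<le> \<bar>p\<bar>} = 2 * ((n - m) div 2 + 1)"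
proof -
  let ?k = "(n - m) div 2"
  have "{p \<in> parity_class n. int m \<le> \<bar>p\<bar>} =
      (\<lambda>i. int n - 2 * int i) ` {..?k} \<union> (\<lambda>i. 2 * int i - int n) ` {..?k}" (is "?T = ?A \<union> ?B")
  proof (intro equalityI subsetI)
    fix p assume p: "p \<in> ?T"
    then obtain j where j: "p = int n + 2 * j" by (auto elim: parity_classE)
    show "p \<in> ?A \<union> ?B"
    proof (cases "p \<ge> 0")
      case True
      with p j assms have "p = int n - 2 * int (nat (-j))" "nat (- j) \<in> {..?k}"
        by (auto simp: parity_class_def)
      then show ?thesis by blast
    next
      case False
      with p j assms have "p = 2 * int (nat (j + int n)) - int n" "nat (j + int n) \<in> {..?k}"
        by (auto simp: parity_class_def)
      then show ?thesis by blast
    qed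
  next
    fix p assume "p \<in> ?A \<union> ?B"
    then show "p \<in> ?T" using assms by (auto simp: parity_class_def)
  qed
  moreover have "?A \<inter> ?B = {}" using assms by auto
  moreover have "card ?A = ?k + 1" "card ?B = ?k + 1"
    by (simp_all add: card_image inj_on_def)
  ultimately show ?thesis by (simp add: card_Un_disjoint)
qed

lemma card_parity_class: "card (parity_class n) = n + 1"
proof -
  have "parity_class n = (\<lambda>i. 2 * int i - int n) ` {..n}"
  proof (intro equalityI subsetI)
    fix p assume p: "p \<in> parity_class n"
    then obtain j where j: "p = int n + 2 * j" by (auto elim: parity_classE)
    with p have "p = 2 * int (nat (j + int n)) - int n" "nat (j + int n) \<in> {..n}"
      by (auto simp: parity_class_def)
    then show "p \<in> (\<lambda>i. 2 * int i - int n) ` {..n}" by blast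
  qed (auto simp: parity_class_def)
  then show ?thesis by (simp add: card_image inj_on_def)
qed

lemma sum_eq_sum_card_tails:
  fixes f :: "'a \<Rightarrow> int"
  assumes "finite A" "\<And>x. x \<in> A \<Longrightarrow> 0 \<le> f x" "\<And>x. x \<in> A \<Longrightarrow> f x \<le> int n"
  shows "sum f A = (\<Sum>m = 1..n. int (card {x \<in> A. int m \<le> f x}))"
proof -
  \<comment> \<open>Layer-cake argument: f x counts the thresholds m from 1 to f x, and the two
    summations are then swapped.\<close>
  have "f x = (\<Sum>m = 1..n. if int m \<le> f x then 1 else 0)" if "x \<in> A" for x
  proof -
    have "{m \<in> {1..n}. int m \<le> f x} = {1..nat (f x)}"
      using assms(2,3)[OF that] by auto
    then show ?thesis using assms(2)[OF that] by (simp add: sum.If_cases Int_def)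
  qed
  then have "sum f A = (\<Sum>x\<in>A. \<Sum>m = 1..n. if int m \<le> f x then 1 else 0)"
    by (rule sum.cong[OF refl])
  also have "\<dots> = (\<Sum>m = 1..n. \<Sum>x\<in>A. if int m \<le> f x then 1 else 0)"
    by (rule sum.swap)
  also have "\<dots> = (\<Sum>m = 1..n. int (card {x \<in> A. int m \<le> f x}))"
    using assms(1) by (simp add: sum.If_cases Int_def)
  finally show ?thesis .
qed

lemma sum_abs_parity_class:
  "(\<Sum>p\<in>parity_class n. \<bar>p\<bar>) = (\<Sum>j<n. 2 * (int (j div 2) + 1))"
proof -
  have "(\<Sum>p\<in>parity_class n. \<bar>p\<bar>) = (\<Sum>m = 1..n. int (card {p \<in> parity_class n. int m \<le> \<bar>p\<bar>}))"
    by (rule sum_eq_sum_card_tails) (auto elim: parity_classE)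
  also have "\<dots> = (\<Sum>m = 1..n. 2 * (int ((n - m) div 2) + 1))"
    by (rule sum.cong) (simp_all add: parity_class_tail)
  also have "\<dots> = (\<Sum>j<n. 2 * (int (j div 2) + 1))"
    by (rule sum.reindex_bij_witness[of _ "\<lambda>j. n - j" "\<lambda>m. n - m"]) auto
  finally show ?thesis .
qed

lemma sum_min_abs_parity_class:
  "(\<Sum>(p, q, r)\<in>cube3 (parity_class n). min \<bar>p\<bar> (min \<bar>q\<bar> \<bar>r\<bar>)) =
     (\<Sum>j<n. (2 * (int (j div 2) + 1)) ^ 3)"
proof -
  let ?f = "\<lambda>(p, q, r). min \<bar>p\<bar> (min \<bar>q\<bar> \<bar>r :: int\<bar>)"
  \<comment> \<open>A minimum reaches m iff all three arguments do, so the tail counts are cubes of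
    those for one coordinate.\<close>
  have tails: "{x \<in> cube3 (parity_class n). int m \<le> ?f x} =
      cube3 {p \<in> parity_class n. int m \<le> \<bar>p\<bar>}" for m
    by auto
  have "sum ?f (cube3 (parity_class n)) =
      (\<Sum>m = 1..n. int (card {x \<in> cube3 (parity_class n). int m \<le> ?f x}))"
    by (rule sum_eq_sum_card_tails) (auto elim: parity_classE)
  also have "\<dots> = (\<Sum>m = 1..n. (2 * (int ((n - m) div 2) + 1)) ^ 3)"
    unfolding tails
    by (rule sum.cong) (simp_all add: card_cartesian_product parity_class_tail power3_eq_cube
        algebra_simps)
  also have "\<dots> = (\<Sum>j<n. (2 * (int (j div 2) + 1)) ^ 3)"
    by (rule sum.reindex_bij_witness[of _ "\<lambda>j. n - j" "\<lambda>m. n - m"]) auto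
  finally show ?thesis .
qed

lemma double_spread:
  assumes "(p, q, r) \<in> cube3 (parity_class n)"
  shows "2 * spread (p, q, r) = \<bar>p\<bar> + \<bar>q\<bar> + \<bar>r\<bar> - min \<bar>p\<bar> (min \<bar>q\<bar> \<bar>r\<bar>)"
proof -
  have "even (\<bar>p\<bar> + \<bar>q\<bar> + \<bar>r\<bar> - min \<bar>p\<bar> (min \<bar>q\<bar> \<bar>r\<bar>))"
    using assms by (auto simp: parity_class_def min_def)
  then show ?thesis by (simp add: spread_def)
qed

lemma sum_spread:
  "8 * sum spread (cube3 (parity_class n)) =
     5 * (int n + 1) ^ 4 - 4 * (int n + 1) ^ 2 - (if even n then 1 else 0)"
proof -
  let ?P = "parity_class n"
  let ?A = "\<Sum>j<n. 2 * (int (j div 2) + 1)"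
  let ?B = "\<Sum>j<n. (2 * (int (j div 2) + 1)) ^ 3"
  \<comment> \<open>The \<open>div 2\<close> makes both closed forms depend on the parity of n; in
    \<open>sum_spread\<close> only a constant of this dependence survives.\<close>
  have A: "2 * ?A = (int n + 1) ^ 2 - (if even n then 1 else 0)"
    by (induction n) (auto elim!: evenE oddE simp: power2_eq_square algebra_simps)
  have B: "4 * ?B = (if even n then ((int n + 1) ^ 2 - 1) ^ 2 else (int n + 1) ^ 4 + 4 * (int n + 1) ^ 2)"
    by (induction n) (auto elim!: evenE oddE simp: power2_eq_square power3_eq_cube power4_eq_xxxx algebra_simps)
  have "2 * sum spread (cube3 ?P) = (\<Sum>x\<in>cube3 ?P. 2 * spread x)"
    by (rule sum_distrib_left)
  also have "\<dots> = (\<Sum>(p, q, r)\<in>cube3 ?P. \<bar>p\<bar> + \<bar>q\<bar> + \<bar>r\<bar> - min \<bar>p\<bar> (min \<bar>q\<bar> \<bar>r\<bar>))"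
    by (rule sum.cong) (auto simp: double_spread)
  also have "\<dots> = (\<Sum>(p, q, r)\<in>cube3 ?P. \<bar>p\<bar> + \<bar>q\<bar> + \<bar>r\<bar>) - ?B"
    unfolding sum_min_abs_parity_class[symmetric] by (simp add: case_prod_unfold sum_subtractf)
  also have "(\<Sum>(p, q, r)\<in>cube3 ?P. \<bar>p\<bar> + \<bar>q\<bar> + \<bar>r\<bar>) = 3 * (int n + 1) ^ 2 * (\<Sum>p\<in>?P. \<bar>p\<bar>)"
    by (simp add: sum.cartesian_product[symmetric] sum.distrib card_parity_class
        sum_distrib_left[symmetric] sum_distrib_right[symmetric] power2_eq_square algebra_simps)
  finally have "8 * sum spread (cube3 ?P) = 6 * (int n + 1) ^ 2 * (2 * ?A) - 4 * ?B"
    by (simp add: sum_abs_parity_class)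
  then show ?thesis unfolding A B
    by (auto simp: power2_eq_square power4_eq_xxxx algebra_simps)
qed

section \<open>Fibres of the face map and the total count\<close>

definition face_sums :: "int \<times> int \<times> int \<times> int \<Rightarrow> int \<times> int \<times> int" where
  "face_sums = (\<lambda>(a, b, c, d). (a + b - c - d, a + c - b - d, a + d - b - c))"

text \<open>The six differences among 0, x, y, z are half sums and half differences of two of the
  arguments of \<open>spread\<close>. The largest absolute value therefore comes from the two
  arguments of largest absolute value.\<close>

lemma spread_eq_max_minus_min:
  "spread (y + z - x, x + z - y, x + y - z) = max (max 0 x) (max y z) - min (min 0 x) (min y z)"
proof -
  let ?p = "y + z - x" and ?q = "x + z - y" and ?r = "x + y - z"
  have "\<bar>?p\<bar> + \<bar>?q\<bar> + \<bar>?r\<bar> - min \<bar>?p\<bar> (min \<bar>?q\<bar> \<bar>?r\<bar>) =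
      2 * (max (max 0 x) (max y z) - min (min 0 x) (min y z))"
    by (smt (verit))
  then show ?thesis by (simp add: spread_def)
qed

lemma card_face_sums_fibre:
  assumes "\<bar>p\<bar> \<le> int t" "\<bar>q\<bar> \<le> int t" "\<bar>r\<bar> \<le> int t" "even (p + q)" "even (q + r)"
  shows "int (card {v \<in> corner_quadruples t. face_sums v = (p, q, r)}) = 2 * int t + 1 - spread (p, q, r)"
proof -
  \<comment> \<open>Here x, y, z are the differences a - b, a - c, a - d, which the face sums
    determine; only a remains free.\<close>
  from assms(5) obtain x where x: "q + r = 2 * x" by (elim evenE)
  from assms(4) obtain z where z: "p + q = 2 * z" by (elim evenE)
  define y where "y = x + z - q"
  have pqr: "p = y + z - x" "q = x + z - y" "r = x + y - z"
    using x z by (simp_all add: y_def)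
  let ?hi = "max (max 0 x) (max y z)" and ?lo = "min (min 0 x) (min y z)"
  have "{v \<in> corner_quadruples t. face_sums v = (p, q, r)} =
      (\<lambda>a. (a, a - x, a - y, a - z)) ` {?hi - int t..?lo + int t}" (is "?F = ?I")
  proof (intro equalityI subsetI)
    fix v assume v: "v \<in> ?F"
    obtain a b c d where abcd: "v = (a, b, c, d)" by (cases v)
    from v have bcd: "b = a - x" "c = a - y" "d = a - z"
      by (auto simp: abcd face_sums_def pqr)
    from v have "\<bar>a\<bar> \<le> int t" "\<bar>a - x\<bar> \<le> int t" "\<bar>a - y\<bar> \<le> int t" "\<bar>a - z\<bar> \<le> int t"
      by (simp_all add: abcd bcd corner_quadruples_def)
    then have "a \<in> {?hi - int t..?lo + int t}"
      by (auto simp: abs_le_iff)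
    then show "v \<in> ?I" unfolding abcd bcd by (rule imageI)
  next
    fix v assume "v \<in> ?I"
    then obtain a where a: "a \<in> {?hi - int t..?lo + int t}" and v: "v = (a, a - x, a - y, a - z)"
      by blast
    from a have "?hi \<le> a + int t" "a - int t \<le> ?lo"
      by (simp_all only: atLeastAtMost_iff diff_le_eq)
    then have "\<bar>a\<bar> \<le> int t" "\<bar>a - x\<bar> \<le> int t" "\<bar>a - y\<bar> \<le> int t" "\<bar>a - z\<bar> \<le> int t"
      unfolding abs_le_iff max.bounded_iff min.bounded_iff by simp_all
    moreover have "face_sums v = (p, q, r)"
      by (simp add: v face_sums_def pqr)
    ultimately show "v \<in> ?F"
      using assms(1-3) by (simp add: v corner_quadruples_def face_sums_def)
  qed
  moreover have "inj_on (\<lambda>a. (a, a - x, a - y, a - z)) {?hi - int t..?lo + int t}"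
    by (simp add: inj_on_def)
  ultimately have "card ?F = nat (?lo - ?hi + 2 * int t + 1)"
    by (simp add: card_image algebra_simps)
  \<comment> \<open>The spread is at most t, so the cardinality formula under \<open>nat\<close> is
    positive and is not cut off.\<close>
  moreover have "?hi - ?lo \<le> int t"
    using assms(1-3) unfolding pqr abs_le_iff by (simp add: min_def max_def)
  ultimately show ?thesis
    unfolding pqr spread_eq_max_minus_min by simp
qed

lemma face_sums_corner_quadruples:
  assumes "v \<in> corner_quadruples (Suc n)"
  shows "face_sums v \<in> cube3 (parity_class (Suc n)) \<union> cube3 (parity_class n)"
proof -
  obtain p q r where pqr: "face_sums v = (p, q, r)" by (cases "face_sums v")
  with assms have le: "\<bar>p\<bar> \<le> int (Suc n)" "\<bar>q\<bar> \<le> int (Suc n)" "\<bar>r\<bar> \<le> int (Suc n)"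
    and parity: "even q \<longleftrightarrow> even p" "even r \<longleftrightarrow> even p"
    by (auto simp: corner_quadruples_def face_sums_def)
  have "x \<in> parity_class (Suc n)" if "\<bar>x\<bar> \<le> int (Suc n)" "even x \<longleftrightarrow> odd n" for x
    using that by (simp add: parity_class_def)
  moreover have "x \<in> parity_class n" if "\<bar>x\<bar> \<le> int (Suc n)" "even x \<longleftrightarrow> even n" for x
  proof -
    \<comment> \<open>Parity excludes the extreme values, which lowers the bound from n + 1 to
      n.\<close>
    have "x \<noteq> int (Suc n)" "x \<noteq> - int (Suc n)" using that(2) by auto
    with that show ?thesis by (auto simp: parity_class_def)
  qed
  ultimately show ?thesis
    using le parity unfolding pqr by (cases "even p \<longleftrightarrow> even n") simp_all
qed

lemma card_corner_quadruples:
  "4 * int (card (corner_quadruples t)) =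
     11 * int t ^ 4 + 22 * int t ^ 3 + 25 * int t ^ 2 + 14 * int t + 4"
proof (cases t)
  \<comment> \<open>Separate because the second parity class belongs to t - 1.\<close>
  case 0
  have "corner_quadruples 0 = {(0, 0, 0, 0)}"
    by (auto simp: corner_quadruples_def)
  with 0 show ?thesis by simp
next
  case (Suc n)
  let ?T1 = "cube3 (parity_class (Suc n))" and ?T0 = "cube3 (parity_class n)"
  let ?w = "\<lambda>x. 2 * int t + 1 - spread x"
  have fin: "finite (corner_quadruples t)"
    using bij_betw_finite[OF bij_betw_corners_of_cube] finite_magic_cubes by blast
  have disjoint: "?T1 \<inter> ?T0 = {}" by (auto simp: parity_class_def)
  have fibre: "int (card {v \<in> corner_quadruples t. face_sums v = x}) = ?w x"
    if "x \<in> ?T1 \<union> ?T0" for x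
  proof -
    obtain p q r where x: "x = (p, q, r)" by (cases x)
    show ?thesis unfolding x
      by (rule card_face_sums_fibre) (use that in \<open>auto simp: x Suc parity_class_def\<close>)
  qed
  have "int (card (corner_quadruples t)) =
      (\<Sum>x\<in>?T1 \<union> ?T0. int (card {v \<in> corner_quadruples t. face_sums v = x}))"
  proof -
    have "face_sums ` corner_quadruples t \<subseteq> ?T1 \<union> ?T0"
      using face_sums_corner_quadruples unfolding Suc by blast
    with fin show ?thesis
      using sum.group[of "corner_quadruples t" "?T1 \<union> ?T0" face_sums "\<lambda>_. 1 :: int"] by simp
  qed
  also have "\<dots> = sum ?w (?T1 \<union> ?T0)"
    using fibre by (intro sum.cong) simp_all
  also have "\<dots> = sum ?w ?T1 + sum ?w ?T0"
    by (rule sum.union_disjoint[OF _ _ disjoint]) simp_all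
  finally have "8 * int (card (corner_quadruples t)) = 8 * (2 * int t + 1) * ((int n + 2) ^ 3 + (int n + 1) ^ 3)
      - 8 * sum spread ?T1 - 8 * sum spread ?T0"
    by (simp add: sum_subtractf card_cartesian_product card_parity_class power3_eq_cube algebra_simps)
  \<comment> \<open>Exactly one of n and n + 1 is even, so the parity terms of the two sums add up
    to the constant 1 in either case.\<close>
  then show ?thesis
    unfolding sum_spread
    by (cases "even n") (simp_all add: Suc power2_eq_square power3_eq_cube power4_eq_xxxx algebra_simps)
qed

theorem theorem2p0p1:
  fixes s :: nat
  shows "real (MC 3 s) =
    (if 3 dvd s
     then 11 / 324 * real s ^ 4 + 11 / 54 * real s ^ 3 + 25 / 36 * real s ^ 2 + 7 / 6 * real s + 1
     else 0)"
proof (cases "3 dvd s")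
  case True
  then obtain t where s: "s = 3 * t" by (elim dvdE)
  have "MC 3 s = card (corner_quadruples t)"
    unfolding MC_def s by (rule bij_betw_same_card[OF bij_betw_corners_of_cube])
  moreover have "real_of_int (4 * int (card (corner_quadruples t))) =
      real_of_int (11 * int t ^ 4 + 22 * int t ^ 3 + 25 * int t ^ 2 + 14 * int t + 4)"
    by (simp only: card_corner_quadruples)
  ultimately show ?thesis
    by (simp add: s power2_eq_square power3_eq_cube power4_eq_xxxx field_simps)
next
  case False
  then have "magic_cubes 3 s = {}"
    using magic_cube_centre by (metis dvd_triv_left equals0I)
  with False show ?thesis by (simp add: MC_def)
qed

end
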